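(* Let $X$ be a vector space of finite dimension $N \ge 3$ over $\mathbb{F}_q$ and let $1 \le k \le N-1$ be an integer. Let $\mathcal{A}$ be a non-empty collection of subspaces of $X$, all of which have codimension $k$. Let $\mathcal{F}$ be the collection of $k$-dimensional subspaces $W \le X$ that are not common complements of the spaces in $\mathcal{A}$. Then $$\frac{\nu_q(N,k,N-k)^2 \, |\mathcal{A}|^2}{\sum_{\ell=0}^{N-k} \nu_q(N,k,\ell) \cdot |\{(A,A') \in \mathcal{A}^2 \mid \dim(A\cap A')=\ell\}|} \le |\mathcal{F}| \le |\mathcal{A}| \, \nu_q(N,k,N-k).$$ In particular, if $|\mathcal{A}| \ge 2$ and $\ell_{\max} := \max\{\dim(A \cap A') \mid A, A' \in \mathcal{A}, \, A \neq A'\}$, then $$\frac{\nu_q(N,k,N-k)^2\,|\mathcal{A}|}{\nu_q(N,k,N-k) + (|\mathcal{A}|-1)\, \nu_q(N,k,\ell_{\max})} \le |\mathcal{F}| \le |\mathcal{A}| \, \nu_q(N,k,N-k).$$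
   Context: $q$ is a prime power. A complement of a subspace $W\le X$ is a subspace $W' \le X$ with $W \oplus W' = X$; a common complement of the spaces in $\mathcal{A}$ is a subspace that is a complement of every $A \in \mathcal{A}$. The $q$-binomial coefficient is $\binom{a}{b}_q = \prod_{i=0}^{b-1} \frac{q^a-q^i}{q^b-q^i}$ for integers $a \ge b \ge 0$. For non-negative integers $N,k,\ell$ with $N \ge 3$, $k<N$ and $N-2k \le \ell \le N-k$, $$\nu_q(N,k,\ell) := \binom{N}{k}_q - 2q^{k(N-k)} + q^{(2k-N+\ell)(N-k)}\prod_{i=\ell}^{N-k-1}(q^{N-k}-q^i),$$ where a product over an empty index set is $1$. In the sum over $\ell$, the terms with $\ell < N-2k$ are zero, because no pair $(A,A')\in\mathcal{A}^2$ satisfies $\dim(A\cap A')=\ell$ for such $\ell$. *)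

theory Defs
  imports Complex_Main "HOL-Library.Cardinality"
begin

text \<open>The ambient space \<open>X\<close> is the whole type of vectors, i.e. \<open>UNIV\<close>.\<close>

context vector_space
begin

definition codim :: "'b set \<Rightarrow> nat" where
  "codim W = dim UNIV - dim W"

definition is_complement :: "'b set \<Rightarrow> 'b set \<Rightarrow> bool" where
  "is_complement W W' \<longleftrightarrow> subspace W' \<and> W \<inter> W' = {0} \<and> {x + y | x y. x \<in> W \<and> y \<in> W'} = UNIV"

definition is_common_complement :: "'b set set \<Rightarrow> 'b set \<Rightarrow> bool" where
  "is_common_complement \<A> W \<longleftrightarrow> subspace W \<and> (\<forall>A\<in>\<A>. local.is_complement A W)"

end

definition q_binomial :: "nat \<Rightarrow> nat \<Rightarrow> nat \<Rightarrow> real" where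
  "q_binomial q a b = (\<Prod>i<b. (real q ^ a - real q ^ i) / (real q ^ b - real q ^ i))"

text \<open>Meant for \<open>k < N\<close> and \<open>N - 2k \<le> l \<le> N - k\<close> (over the integers). In that range the natural number
  \<open>2 * k + l - N\<close> is the integer \<open>2k - N + l\<close>; below it the subtraction truncates and the value of
  \<open>nu\<close> has no meaning.\<close>

definition nu :: "nat \<Rightarrow> nat \<Rightarrow> nat \<Rightarrow> nat \<Rightarrow> real" where
  "nu q N k l = q_binomial q N k - 2 * real q ^ (k * (N - k))
     + real q ^ ((2 * k + l - N) * (N - k)) * (\<Prod>i\<in>{l..<N - k}. real q ^ (N - k) - real q ^ i)"

end

theory Submission
  imports Defs "HOL-Library.FuncSet" "HOL-Analysis.Convex"
begin

text \<open>
  Write \<open>n = N - k\<close> for the dimension of the members of \<open>\<A>\<close>. The number \<open>nu q N k l\<close> counts the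
  \<open>k\<close>-dimensional subspaces \<open>W\<close> that are complements of neither \<open>A\<close> nor \<open>A'\<close>, for any two
  \<open>n\<close>-dimensional subspaces with \<open>dim (A \<inter> A') = l\<close> (lemma \<open>nu_eq_card\<close>). Let \<open>d W\<close> be the number of
  \<open>A \<in> \<A>\<close> of which \<open>W\<close> is not a complement, so that \<open>\<F>\<close> consists of those \<open>W\<close> with \<open>d W \<ge> 1\<close>. Double
  counting gives \<open>\<Sum>W\<in>\<F>. d W = card \<A> * nu q N k n\<close>, which proves the upper bound, and it identifies
  \<open>\<Sum>W\<in>\<F>. (d W)\<^sup>2\<close> with the sum of \<open>nu q N k (dim (A \<inter> A'))\<close> over all pairs. The lower bound is the
  Cauchy-Schwarz inequality \<open>(\<Sum>W\<in>\<F>. d W)\<^sup>2 \<le> card \<F> * (\<Sum>W\<in>\<F>. (d W)\<^sup>2)\<close> (lemma \<open>card_covered_bounds\<close>). The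
  version with the maximal intersection dimension follows because \<open>nu q N k l\<close> does not
  decrease when \<open>l\<close> grows from \<open>N - 2k\<close> to \<open>n\<close> (lemma \<open>nu_mono\<close>).

  By inclusion and exclusion, the formula for \<open>nu\<close> reduces to counting all \<open>k\<close>-dimensional subspaces
  (lemma \<open>card_subspaces_of_dim\<close>) and the common complements of \<open>A\<close> and \<open>A'\<close> (lemma
  \<open>card_common_complements\<close>). For the latter, choose a basis \<open>C\<close> of the space modulo \<open>A\<close>. A complement
  of \<open>A\<close> is the same as a function \<open>f : C \<rightarrow> A\<close>, the complement being spanned by the vectors \<open>c + f c\<close>
  (lemma \<open>bij_betw_graph\<close>). If \<open>C\<close> is chosen to contain a basis \<open>B\<close> of \<open>A'\<close> modulo \<open>A \<inter> A'\<close>, then this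
  complement is also a complement of \<open>A'\<close> if and only if the vectors \<open>f b\<close>, \<open>b \<in> B\<close>, are linearly
  independent modulo \<open>A \<inter> A'\<close> (lemma \<open>graph_Int_trivial_iff\<close>); the values on \<open>C - B\<close> are free. There are
  \<open>\<Prod>i\<in>{l..<n}. q ^ n - q ^ i\<close> independent choices on \<open>B\<close> (lemma \<open>card_indep_families\<close>) and
  \<open>q ^ n\<close> choices for each of the \<open>2 * k + l - N\<close> remaining elements of \<open>C\<close>.
\<close>

section \<open>Generation and independence modulo a subspace\<close>

text \<open>A vector space of finite dimension \<open>N\<close> over a field with \<open>q\<close> elements.\<close>

locale finite_field_space = finite_dimensional_vector_space scale Basis
  for scale :: "'f::{field,finite} \<Rightarrow> 'v::ab_group_add \<Rightarrow> 'v"  (infixr "*s" 75)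
    and Basis :: "'v set" +
  fixes q N :: nat
  assumes q_eq: "q = CARD('f)" and dim_space: "dim (UNIV :: 'v set) = N"
begin

text \<open>The family \<open>(f b)\<close>, \<open>b \<in> B\<close>, is linearly independent modulo \<open>D\<close>. Families instead of sets are
  used because the counting below is over functions; \<open>B\<close> is always finite.\<close>

definition indep_mod :: "'v set \<Rightarrow> ('i \<Rightarrow> 'v) \<Rightarrow> 'i set \<Rightarrow> bool" where
  "indep_mod D f B \<longleftrightarrow> (\<forall>u. (\<Sum>b\<in>B. u b *s f b) \<in> D \<longrightarrow> (\<forall>b\<in>B. u b = 0))"

text \<open>The subspace generated by \<open>D\<close> and the family \<open>(f b)\<close>, \<open>b \<in> B\<close>, for a subspace \<open>D\<close> and a finite
  index set \<open>B\<close>.\<close>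

definition gen :: "'v set \<Rightarrow> ('i \<Rightarrow> 'v) \<Rightarrow> 'i set \<Rightarrow> 'v set" where
  "gen D f B = {d + (\<Sum>b\<in>B. u b *s f b) | d u. d \<in> D}"

lemma q_gt_1: "q > 1"
proof -
  have "card {0, 1 :: 'f} \<le> CARD('f)"
    by (rule card_mono) auto
  then show ?thesis by (simp add: q_eq)
qed

lemma indep_modD: "indep_mod D f B \<Longrightarrow> (\<Sum>b\<in>B. u b *s f b) \<in> D \<Longrightarrow> b \<in> B \<Longrightarrow> u b = 0"
  by (auto simp: indep_mod_def)

lemma indep_mod_cong: "(\<And>b. b \<in> B \<Longrightarrow> f b = g b) \<Longrightarrow> indep_mod D f B = indep_mod D g B"
  by (auto simp: indep_mod_def cong: sum.cong)

lemma gen_cong: "(\<And>b. b \<in> B \<Longrightarrow> f b = g b) \<Longrightarrow> gen D f B = gen D g B"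
  by (auto simp: gen_def cong: sum.cong)

lemma genI: "d \<in> D \<Longrightarrow> d + (\<Sum>b\<in>B. u b *s f b) \<in> gen D f B"
  by (auto simp: gen_def)

lemma gen_family_mem:
  assumes "subspace D" "finite B" "b \<in> B"
  shows "f b \<in> gen D f B"
proof -
  have "(\<Sum>c\<in>B. (if c = b then 1 else 0) *s f c) = (\<Sum>c\<in>B. if c = b then f c else 0)"
    by (rule sum.cong) auto
  also have "\<dots> = f b" using assms by (simp add: sum.delta)
  finally have "(\<Sum>c\<in>B. (if c = b then 1 else 0) *s f c) = f b" .
  then show ?thesis
    using genI[OF subspace_0[OF assms(1)], of "\<lambda>c. if c = b then 1 else 0" f B] by simp
qed

lemma subspace_gen:
  assumes "subspace D"
  shows "subspace (gen D f B)"
proof (rule subspaceI)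
  show "0 \<in> gen D f B"
    using genI[OF subspace_0[OF assms], of "\<lambda>_. 0" f B] by simp
next
  fix x y assume "x \<in> gen D f B" "y \<in> gen D f B"
  then obtain d u d' u' where "d \<in> D" "d' \<in> D"
    "x = d + (\<Sum>b\<in>B. u b *s f b)" "y = d' + (\<Sum>b\<in>B. u' b *s f b)"
    by (auto simp: gen_def)
  then show "x + y \<in> gen D f B"
    using genI[OF subspace_add[OF assms \<open>d \<in> D\<close> \<open>d' \<in> D\<close>], of "\<lambda>b. u b + u' b" f B]
    by (simp add: scale_left_distrib sum.distrib algebra_simps)
next
  fix c x assume "x \<in> gen D f B"
  then obtain d u where "d \<in> D" "x = d + (\<Sum>b\<in>B. u b *s f b)"
    by (auto simp: gen_def)
  then show "c *s x \<in> gen D f B"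
    using genI[OF subspace_scale[OF assms \<open>d \<in> D\<close>], of c "\<lambda>b. c * u b" f B]
    by (simp add: scale_right_distrib scale_sum_right)
qed

lemma gen_subset:
  assumes "subspace A" "D \<subseteq> A" "\<And>b. b \<in> B \<Longrightarrow> f b \<in> A"
  shows "gen D f B \<subseteq> A"
proof
  fix x assume "x \<in> gen D f B"
  then obtain d u where "d \<in> D" and x: "x = d + (\<Sum>b\<in>B. u b *s f b)"
    by (auto simp: gen_def)
  moreover have "(\<Sum>b\<in>B. u b *s f b) \<in> A"
    by (intro subspace_sum[OF assms(1)] subspace_scale[OF assms(1)] assms(3))
  ultimately show "x \<in> A"
    using assms(2) subspace_add[OF assms(1), of d] by (simp add: subset_iff)
qed

lemma gen_image:
  "gen D f B = (\<lambda>(d, u). d + (\<Sum>b\<in>B. u b *s f b)) ` (D \<times> (B \<rightarrow>\<^sub>E UNIV))" (is "_ = ?r")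
proof
  show "gen D f B \<subseteq> ?r"
  proof
    fix x assume "x \<in> gen D f B"
    then obtain d u where d: "d \<in> D" and x: "x = d + (\<Sum>b\<in>B. u b *s f b)"
      by (auto simp: gen_def)
    have "x = d + (\<Sum>b\<in>B. restrict u B b *s f b)"
      unfolding x by (simp cong: sum.cong)
    with d show "x \<in> ?r"
      by (intro image_eqI[of _ _ "(d, restrict u B)"]) simp_all
  qed
qed (auto simp: gen_def)

text \<open>If the family is independent modulo \<open>D\<close>, then every element of \<open>gen D f B\<close> has unique
  coordinates \<open>(d, u)\<close>, with \<open>d \<in> D\<close> and \<open>u : B \<rightarrow> F\<^sub>q\<close>.\<close>

lemma card_gen:
  assumes D: "subspace D" and B: "finite B" and ind: "indep_mod D f B"
  shows "card (gen D f B) = card D * q ^ card B"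
proof -
  have "inj_on (\<lambda>(d, u). d + (\<Sum>b\<in>B. u b *s f b)) (D \<times> (B \<rightarrow>\<^sub>E UNIV))"
  proof (rule inj_onI, clarify)
    fix d u d' u' assume d: "d \<in> D" "d' \<in> D" and u: "u \<in> B \<rightarrow>\<^sub>E UNIV" "u' \<in> B \<rightarrow>\<^sub>E (UNIV :: 'f set)"
      and eq: "d + (\<Sum>b\<in>B. u b *s f b) = d' + (\<Sum>b\<in>B. u' b *s f b)"
    have "(\<Sum>b\<in>B. (u b - u' b) *s f b) = d' - d"
      using eq by (simp add: scale_left_diff_distrib sum_subtractf algebra_simps)
    then have "(\<Sum>b\<in>B. (u b - u' b) *s f b) \<in> D"
      using D d by (simp add: subspace_diff)
    from indep_modD[OF ind this] have "u b = u' b" if "b \<in> B" for b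
      using that by simp
    with u have "u = u'" by (blast intro: PiE_ext)
    with eq show "d = d' \<and> u = u'" by simp
  qed
  then show ?thesis
    by (simp add: gen_image card_image card_cartesian_product card_funcsetE B q_eq)
qed

text \<open>The step by which independent families are counted: a new vector may be added precisely when it
  avoids the subspace generated so far.\<close>

lemma indep_mod_insert:
  assumes D: "subspace D" and B: "finite B" and b: "b \<notin> B"
  shows "indep_mod D f (insert b B) \<longleftrightarrow> indep_mod D f B \<and> f b \<notin> gen D f B" (is "?l \<longleftrightarrow> ?r")
proof
  assume l: ?l
  have "u c = 0" if "(\<Sum>b\<in>B. u b *s f b) \<in> D" "c \<in> B" for u c
  proof -
    have "(\<Sum>c\<in>insert b B. (u(b := 0)) c *s f c) = (\<Sum>b\<in>B. u b *s f b)"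
      using B b by (auto intro!: sum.cong)
    with l that have "(u(b := 0)) c = 0"
      by (intro indep_modD[OF l]) auto
    with b that show ?thesis by (auto split: if_splits)
  qed
  moreover have "f b \<notin> gen D f B"
  proof
    assume "f b \<in> gen D f B"
    then obtain d u where d: "d \<in> D" and eq: "f b = d + (\<Sum>b\<in>B. u b *s f b)"
      by (auto simp: gen_def)
    have "(\<Sum>c\<in>insert b B. ((\<lambda>c. - u c)(b := 1)) c *s f c) = f b + (\<Sum>c\<in>B. - u c *s f c)"
      using B b by (auto intro!: sum.cong)
    also have "\<dots> = d" by (simp add: eq sum_negf)
    finally have "((\<lambda>c. - u c)(b := 1)) b = 0"
      using d by (intro indep_modD[OF l]) auto
    then show False by simp
  qed
  ultimately show ?r by (auto simp: indep_mod_def)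
next
  assume r: ?r
  show ?l unfolding indep_mod_def
  proof (intro allI impI)
    fix u assume u: "(\<Sum>b\<in>insert b B. u b *s f b) \<in> D"
    then have s: "u b *s f b + (\<Sum>b\<in>B. u b *s f b) \<in> D" (is "?s \<in> D")
      using B b by simp
    have ub: "u b = 0"
    proof (rule ccontr)
      assume nz: "u b \<noteq> 0"
      have "f b = inverse (u b) *s ?s + (\<Sum>c\<in>B. (- inverse (u b) * u c) *s f c)"
        using nz by (simp add: scale_right_distrib scale_sum_right sum_negf)
      also have "\<dots> \<in> gen D f B"
        by (intro genI subspace_scale D s)
      finally show False using r by simp
    qed
    with s have "(\<Sum>b\<in>B. u b *s f b) \<in> D" by simp
    with r ub show "\<forall>b\<in>insert b B. u b = 0" by (auto dest: indep_modD)
  qed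
qed

section \<open>Subspaces of a space over a finite field\<close>

lemma finite_space: "finite (UNIV :: 'v set)"
proof -
  have "UNIV \<subseteq> gen {0} (\<lambda>b. b) Basis"
    using span_Basis span_finite[OF finite_Basis] by (auto simp: gen_def)
  moreover have "finite (gen {0} (\<lambda>b. b) Basis)"
    unfolding gen_image by (intro finite_imageI finite_cartesian_product finite_PiE finite_Basis) auto
  ultimately show ?thesis by (rule finite_subset)
qed

lemma finite_vectors [simp]: "finite (S :: 'v set)"
  using finite_space by (rule finite_subset[rotated]) simp

lemma finite_sets_of_vectors [simp]: "finite (K :: 'v set set)"
proof (rule finite_subset)
  show "K \<subseteq> Pow UNIV" by blast
  show "finite (Pow (UNIV :: 'v set))" by (subst finite_Pow_iff) (rule finite_space)
qed

lemma card_subspace: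
  assumes "subspace S"
  shows "card S = q ^ dim S"
proof -
  obtain B where B: "B \<subseteq> S" "independent B" "S \<subseteq> span B" "card B = dim S"
    using basis_exists by blast
  have "S = span B" using B assms by (simp add: span_subspace)
  also have "\<dots> = gen {0} (\<lambda>b. b) B"
    by (auto simp: gen_def span_finite)
  finally have "S = gen {0} (\<lambda>b. b) B" .
  moreover have "indep_mod {0} (\<lambda>b. b) B"
    using B(2) by (auto simp: indep_mod_def independent_explicit)
  ultimately show ?thesis
    using card_gen[of "{0}" B "\<lambda>b. b"] B(4) by (simp add: subspace_single_0)
qed

lemma subspace_eq_if_dim_eq:
  assumes "subspace S" "subspace T" "S \<subseteq> T" "dim S = dim T"
  shows "S = T"
  using assms by (intro card_subset_eq) (simp_all add: card_subspace)

text \<open>Every subspace \<open>T \<supseteq> S\<close> has a basis modulo \<open>S\<close>, that is, a set of vectors whose classes form a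
  basis of \<open>T / S\<close>. Since everything is finite, an independent set of maximal size will do.\<close>

lemma basis_mod_exists:
  assumes S: "subspace S" and T: "subspace T" and sub: "S \<subseteq> T"
  obtains C where "C \<subseteq> T" "indep_mod S (\<lambda>c. c) C" "gen S (\<lambda>c. c) C = T"
    "dim T = dim S + card C"
proof -
  let ?P = "\<lambda>C. C \<subseteq> T \<and> indep_mod S (\<lambda>c. c) C"
  have "?P {}" by (simp add: indep_mod_def)
  moreover have "\<forall>C. ?P C \<longrightarrow> card C \<le> card T" by (simp add: card_mono)
  ultimately obtain C where C: "?P C" and max: "\<And>C'. ?P C' \<Longrightarrow> card C' \<le> card C"
    using ex_has_greatest_nat[of ?P "{}" card "card T + 1"] by (auto simp: less_Suc_eq_le)
  have gT: "gen S (\<lambda>c. c) C \<subseteq> T" using C T sub by (intro gen_subset) auto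
  moreover have "x \<in> gen S (\<lambda>c. c) C" if x: "x \<in> T" for x
  proof (rule ccontr)
    assume nx: "x \<notin> gen S (\<lambda>c. c) C"
    with gen_family_mem[OF S, of C x "\<lambda>c. c"] have xC: "x \<notin> C" by auto
    have "?P (insert x C)" using x C nx xC by (simp add: indep_mod_insert[OF S])
    from max[OF this] xC show False by simp
  qed
  ultimately have gen: "gen S (\<lambda>c. c) C = T" by blast
  have "q ^ dim T = q ^ (dim S + card C)"
    using card_gen[OF S, of C "\<lambda>c. c"] C gen by (simp add: card_subspace S T power_add)
  then have "dim T = dim S + card C" using q_gt_1 by simp
  with C gen that show ?thesis by blast
qed

section \<open>Counting independent families and subspaces\<close>

text \<open>Building a family on \<open>insert x S\<close> by first choosing its restriction to \<open>S\<close> (subject to \<open>Q\<close>) and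
  then a value at \<open>x\<close> outside a forbidden set that depends on this restriction only.\<close>

lemma card_PiE_insert_filter:
  assumes S: "finite S" and x: "x \<notin> S" and A: "finite A"
    and Q: "\<And>g y. Q (g(x := y)) \<longleftrightarrow> Q g"
    and H: "\<And>g y. H (g(x := y)) = H g"
    and m: "\<And>g. g \<in> S \<rightarrow>\<^sub>E A \<Longrightarrow> Q g \<Longrightarrow> card (A - H g) = m"
  shows "card {f \<in> insert x S \<rightarrow>\<^sub>E A. Q f \<and> f x \<notin> H f} = card {f \<in> S \<rightarrow>\<^sub>E A. Q f} * m"
proof -
  let ?T = "Sigma {f \<in> S \<rightarrow>\<^sub>E A. Q f} (\<lambda>g. A - H g)"
  have "{f \<in> insert x S \<rightarrow>\<^sub>E A. Q f \<and> f x \<notin> H f} = (\<lambda>(g, y). g(x := y)) ` ?T"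
  proof (intro set_eqI iffI)
    fix f assume f: "f \<in> {f \<in> insert x S \<rightarrow>\<^sub>E A. Q f \<and> f x \<notin> H f}"
    then obtain g y where gy: "g \<in> S \<rightarrow>\<^sub>E A" "y \<in> A" "f = g(x := y)"
      by (auto simp: PiE_insert_eq)
    with f show "f \<in> (\<lambda>(g, y). g(x := y)) ` ?T"
      by (intro image_eqI[of _ _ "(g, y)"]) (simp_all add: Q H)
  next
    fix f assume "f \<in> (\<lambda>(g, y). g(x := y)) ` ?T"
    then obtain g y where "g \<in> S \<rightarrow>\<^sub>E A" "Q g" "y \<in> A" "y \<notin> H g" "f = g(x := y)"
      by auto
    then show "f \<in> {f \<in> insert x S \<rightarrow>\<^sub>E A. Q f \<and> f x \<notin> H f}"
      by (auto simp: Q H PiE_iff extensional_def)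
  qed
  moreover have "inj_on (\<lambda>(g, y). g(x := y)) ?T"
  proof (rule inj_onI, clarify)
    fix g y g' y' assume g: "g \<in> S \<rightarrow>\<^sub>E A" "g' \<in> S \<rightarrow>\<^sub>E A" and eq: "g(x := y) = g'(x := y')"
    have "(y, g) = (y', g')"
      using inj_onD[OF inj_combinator[OF x, of "\<lambda>_. UNIV"], of "(y, g)" "(y', g')"] g eq
      by (auto simp: PiE_iff)
    then show "g = g' \<and> y = y'" by simp
  qed
  moreover have "card ?T = (\<Sum>g\<in>{f \<in> S \<rightarrow>\<^sub>E A. Q f}. card (A - H g))"
    using S A by (intro card_SigmaI) (simp_all add: finite_PiE)
  ultimately show ?thesis by (simp add: card_image m)
qed

text \<open>The vectors are chosen one after the other; the vector after the first \<open>i\<close> ones has to avoid a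
  subspace of dimension \<open>dim D + i\<close>. If \<open>card B > dim A - dim D\<close>, then both sides are zero.\<close>

lemma card_indep_families:
  assumes D: "subspace D" and A: "subspace A" and DA: "D \<subseteq> A" and "finite B"
  shows "real (card {f \<in> B \<rightarrow>\<^sub>E A. indep_mod D f B})
    = (\<Prod>i<card B. real q ^ dim A - real q ^ (dim D + i))"
  using \<open>finite B\<close>
proof (induction B rule: finite_induct)
  case empty
  then show ?case by (simp add: indep_mod_def)
next
  case (insert x B)
  let ?F = "{f \<in> B \<rightarrow>\<^sub>E A. indep_mod D f B}"
  let ?m = "card A - q ^ (dim D + card B)"
  have gen: "gen D f B \<subseteq> A" "card (gen D f B) = q ^ (dim D + card B)" if "f \<in> ?F" for f
  proof -
    show "gen D f B \<subseteq> A" using that by (intro gen_subset A DA) auto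
    show "card (gen D f B) = q ^ (dim D + card B)"
      using that D insert.hyps by (simp add: card_gen card_subspace power_add)
  qed
  have upd: "indep_mod D (g(x := y)) B = indep_mod D g B" "gen D (g(x := y)) B = gen D g B" for g y
    using insert.hyps by (auto intro!: indep_mod_cong gen_cong)
  have "{f \<in> insert x B \<rightarrow>\<^sub>E A. indep_mod D f (insert x B)}
      = {f \<in> insert x B \<rightarrow>\<^sub>E A. indep_mod D f B \<and> f x \<notin> gen D f B}"
    using insert.hyps by (simp add: indep_mod_insert D)
  moreover have "card \<dots> = card ?F * ?m"
    by (rule card_PiE_insert_filter)
      (use insert.hyps upd gen in \<open>simp_all add: card_Diff_subset\<close>)
  ultimately have "real (card {f \<in> insert x B \<rightarrow>\<^sub>E A. indep_mod D f (insert x B)})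
      = real (card ?F) * real ?m"
    by simp
  also have "\<dots> = real (card ?F) * (real q ^ dim A - real q ^ (dim D + card B))"
  proof (cases "?F = {}")
    case True
    then show ?thesis by (simp only: card.empty)
  next
    case False
    then obtain f where "f \<in> ?F" by blast
    from gen[OF this] have "q ^ (dim D + card B) \<le> card A"
      using card_mono[of A "gen D f B"] by simp
    then show ?thesis by (simp add: of_nat_diff card_subspace A)
  qed
  finally show ?case
    using insert by (simp add: mult.commute)
qed

text \<open>The ordered bases of the \<open>k\<close>-dimensional subspaces are the independent \<open>k\<close>-tuples of vectors, and
  each subspace has \<open>\<Prod>i<k. q ^ k - q ^ i\<close> ordered bases.\<close>

lemma card_subspaces_of_dim:
  assumes "k \<le> N"
  shows "real (card {W. subspace W \<and> dim W = k}) = q_binomial q N k"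
proof -
  define I where "I = {..<k}"
  define F where "F = {f \<in> I \<rightarrow>\<^sub>E (UNIV :: 'v set). indep_mod {0} f I}"
  let ?K = "{W. subspace W \<and> dim W = k}"
  have I: "finite I" "card I = k" by (simp_all add: I_def)
  have z: "subspace ({0} :: 'v set)" by (rule subspace_single_0)
  have cg: "card (gen {0} f I) = q ^ k" if "indep_mod {0} f I" for f
    using card_gen[OF z I(1) that] I by simp
  have fib: "{f \<in> F. gen {0} f I = W} = {f \<in> I \<rightarrow>\<^sub>E W. indep_mod {0} f I}" if W: "W \<in> ?K" for W
  proof (intro set_eqI iffI)
    fix f assume "f \<in> {f \<in> F. gen {0} f I = W}"
    then show "f \<in> {f \<in> I \<rightarrow>\<^sub>E W. indep_mod {0} f I}"
      using gen_family_mem[OF z I(1), of _ f] by (auto simp: F_def PiE_iff)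
  next
    fix f assume f: "f \<in> {f \<in> I \<rightarrow>\<^sub>E W. indep_mod {0} f I}"
    then have "gen {0} f I \<subseteq> W"
      using W by (intro gen_subset) (auto simp: subspace_0)
    moreover have "card (gen {0} f I) = card W"
      using f W by (simp add: cg card_subspace)
    ultimately have "gen {0} f I = W" by (intro card_subset_eq) auto
    with f show "f \<in> {f \<in> F. gen {0} f I = W}" by (auto simp: F_def PiE_iff)
  qed
  have "gen {0} f I \<in> ?K" if "f \<in> F" for f
  proof -
    have "q ^ dim (gen {0} f I) = q ^ k"
      using that cg[of f] card_subspace[OF subspace_gen[OF z, of f I]] by (simp add: F_def)
    then show ?thesis using q_gt_1 z by (simp add: subspace_gen)
  qed
  then have "(\<Sum>W\<in>?K. \<Sum>f\<in>{f \<in> F. gen {0} f I = W}. 1 :: real) = (\<Sum>f\<in>F. 1)"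
    by (intro sum.group) (auto simp: F_def I finite_PiE)
  then have "real (card F) = (\<Sum>W\<in>?K. real (card {f \<in> F. gen {0} f I = W}))"
    by simp
  also have "\<dots> = (\<Sum>W\<in>?K. \<Prod>i<k. real q ^ k - real q ^ i)"
    by (intro sum.cong refl)
      (simp add: fib card_indep_families[OF z] subspace_0 I)
  finally have "real (card F) = real (card ?K) * (\<Prod>i<k. real q ^ k - real q ^ i)"
    by simp
  moreover have "real (card F) = (\<Prod>i<k. real q ^ N - real q ^ i)"
    unfolding F_def using dim_space by (simp add: card_indep_families[OF z] I)
  moreover have "(\<Prod>i<k. real q ^ k - real q ^ i) \<noteq> 0"
    using q_gt_1 by simp
  ultimately show ?thesis
    by (simp add: q_binomial_def prod_dividef field_simps)
qed

section \<open>Complements as graphs\<close>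

lemma dim_complement:
  assumes "subspace A" "is_complement A W"
  shows "dim A + dim W = N"
  using dim_sums_Int[of A W] assms dim_space by (simp add: is_complement_def)

lemma is_complement_iff_Int:
  assumes A: "subspace A" and W: "subspace W" and dim: "dim A + dim W = N"
  shows "is_complement A W \<longleftrightarrow> A \<inter> W = {0}"
proof
  assume Int: "A \<inter> W = {0}"
  have "{x + y | x y. x \<in> A \<and> y \<in> W} = UNIV"
    using dim_sums_Int[OF A W] dim dim_space Int
    by (intro subspace_eq_if_dim_eq subspace_sums A W) auto
  with Int W show "is_complement A W" by (simp add: is_complement_def)
qed (simp add: is_complement_def)

text \<open>If \<open>C\<close> is a basis of the whole space modulo \<open>A\<close> and \<open>f\<close> maps \<open>C\<close> to \<open>A\<close>, then \<open>graph C f\<close> is the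
  graph of the linear map \<open>span C \<rightarrow> A\<close> that extends \<open>f\<close>, as a subspace of \<open>span C \<oplus> A\<close>.\<close>

definition graph :: "'v set \<Rightarrow> ('v \<Rightarrow> 'v) \<Rightarrow> 'v set" where
  "graph C f = gen {0} (\<lambda>c. c + f c) C"

lemma sum_add_scale:
  "(\<Sum>c\<in>C. u c *s (c + f c)) = (\<Sum>c\<in>C. u c *s c) + (\<Sum>c\<in>C. u c *s f c)"
  by (simp add: scale_right_distrib sum.distrib)

text \<open>Modulo \<open>A\<close>, the vector \<open>c + f c\<close> is the same as \<open>c\<close>.\<close>

lemma graph_mem_imp_coeffs_0:
  assumes A: "subspace A" and C: "indep_mod A (\<lambda>c. c) C" and f: "\<And>c. c \<in> C \<Longrightarrow> f c \<in> A"
    and mem: "(\<Sum>c\<in>C. u c *s (c + f c)) \<in> A" and c: "c \<in> C"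
  shows "u c = 0"
proof (rule indep_modD[OF C _ c])
  have "(\<Sum>c\<in>C. u c *s f c) \<in> A"
    by (intro subspace_sum[OF A] subspace_scale[OF A] f)
  from subspace_diff[OF A mem this] show "(\<Sum>c\<in>C. u c *s c) \<in> A"
    by (simp add: sum_add_scale)
qed

lemma graph_is_complement:
  assumes A: "subspace A" and C: "indep_mod A (\<lambda>c. c) C" "N = dim A + card C"
    and f: "\<And>c. c \<in> C \<Longrightarrow> f c \<in> A"
  shows "is_complement A (graph C f)"
proof -
  have z: "subspace ({0} :: 'v set)" by (rule subspace_single_0)
  have sub: "subspace (graph C f)" unfolding graph_def by (rule subspace_gen[OF z])
  have "indep_mod {0} (\<lambda>c. c + f c) C"
    unfolding indep_mod_def
  proof (intro allI impI ballI)
    fix u c assume "(\<Sum>c\<in>C. u c *s (c + f c)) \<in> {0}" and c: "c \<in> C"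
    then have mem: "(\<Sum>c\<in>C. u c *s (c + f c)) \<in> A"
      using subspace_0[OF A] by (metis singletonD)
    show "u c = 0"
      by (rule graph_mem_imp_coeffs_0[where f = f, OF A C(1) _ mem c]) (rule f)
  qed
  then have "card (graph C f) = q ^ card C"
    using card_gen[OF z, of C "\<lambda>c. c + f c"] by (simp add: graph_def)
  then have "dim A + dim (graph C f) = N"
    using q_gt_1 C(2) by (simp add: card_subspace[OF sub])
  moreover have "A \<inter> graph C f = {0}"
  proof (intro equalityI subsetI)
    fix x assume x: "x \<in> A \<inter> graph C f"
    then obtain u where u: "x = (\<Sum>c\<in>C. u c *s (c + f c))"
      by (auto simp: graph_def gen_def)
    have mem: "(\<Sum>c\<in>C. u c *s (c + f c)) \<in> A" using x unfolding u by blast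
    have "u c = 0" if "c \<in> C" for c
      by (rule graph_mem_imp_coeffs_0[where f = f, OF A C(1) _ mem that]) (rule f)
    then show "x \<in> {0}" unfolding u by simp
  qed (use subspace_0 A sub in auto)
  ultimately show ?thesis by (simp add: is_complement_iff_Int A sub)
qed

text \<open>The complements of \<open>A\<close> are the graphs: a complement \<open>W\<close> meets every coset \<open>c + A\<close> in exactly one
  vector \<open>c + f c\<close>.\<close>

lemma bij_betw_graph:
  assumes A: "subspace A" and C: "indep_mod A (\<lambda>c. c) C" "N = dim A + card C"
  shows "bij_betw (graph C) (C \<rightarrow>\<^sub>E A) {W. is_complement A W}"
  unfolding bij_betw_def
proof
  have z: "subspace ({0} :: 'v set)" by (rule subspace_single_0)
  have mem: "c + f c \<in> graph C f" if "c \<in> C" for c f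
    unfolding graph_def by (rule gen_family_mem[OF z _ that]) simp
  have comp: "is_complement A (graph C f)" if "f \<in> C \<rightarrow>\<^sub>E A" for f
    using that by (intro graph_is_complement A C) auto
  show "inj_on (graph C) (C \<rightarrow>\<^sub>E A)"
  proof (rule inj_onI)
    fix f g assume fg: "f \<in> C \<rightarrow>\<^sub>E A" "g \<in> C \<rightarrow>\<^sub>E A" and eq: "graph C f = graph C g"
    have "f c = g c" if c: "c \<in> C" for c
    proof -
      have "subspace (graph C f)" using comp[OF fg(1)] by (simp add: is_complement_def)
      then have "(c + f c) - (c + g c) \<in> graph C f"
        using mem[OF c, of f] mem[OF c, of g] eq by (metis subspace_diff)
      moreover have "f c - g c \<in> A"
        using fg c by (intro subspace_diff A) auto
      ultimately have "f c - g c \<in> A \<inter> graph C f" by simp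
      moreover have "A \<inter> graph C f = {0}"
        using comp[OF fg(1)] by (simp add: is_complement_def)
      ultimately have "f c - g c = 0" by (metis singletonD)
      then show ?thesis by simp
    qed
    with fg show "f = g" by (blast intro: PiE_ext)
  qed
  show "graph C ` (C \<rightarrow>\<^sub>E A) = {W. is_complement A W}"
  proof (intro equalityI subsetI)
    fix W assume "W \<in> {W. is_complement A W}"
    then have W: "is_complement A W" and sW: "subspace W" by (simp_all add: is_complement_def)
    have "\<exists>a\<in>A. c + a \<in> W" for c
    proof -
      have "c \<in> {x + y | x y. x \<in> A \<and> y \<in> W}" using W by (simp add: is_complement_def)
      then obtain x y where "x \<in> A" "y \<in> W" "c = x + y" by blast
      then show ?thesis by (intro bexI[of _ "- x"]) (simp_all add: A subspace_neg)
    qed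
    then obtain f where f: "f c \<in> A" "c + f c \<in> W" for c by metis
    let ?g = "restrict f C"
    have g: "?g \<in> C \<rightarrow>\<^sub>E A" using f by auto
    have "graph C ?g \<subseteq> W"
      unfolding graph_def using f sW by (intro gen_subset) (auto simp: subspace_0)
    moreover have "subspace (graph C ?g)" using comp[OF g] by (simp add: is_complement_def)
    moreover have "dim (graph C ?g) = dim W"
      using dim_complement[OF A W] dim_complement[OF A comp[OF g]] by simp
    ultimately have "graph C ?g = W" using sW by (simp add: subspace_eq_if_dim_eq)
    with g show "W \<in> graph C ` (C \<rightarrow>\<^sub>E A)" by blast
  qed (use comp in auto)
qed

text \<open>Being a complement of a second space \<open>A'\<close> is a condition on the values of \<open>f\<close> on a basis \<open>B\<close> of
  \<open>A'\<close> modulo \<open>A \<inter> A'\<close> only. The reason is that a vector of the graph lying in \<open>A' = (A \<inter> A') + span B\<close>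
  has coordinates supported on \<open>B\<close>, and \<open>\<Sum>u b (b + f b)\<close> (with \<open>b \<in> B\<close>) is in \<open>A'\<close> exactly when
  \<open>\<Sum>u b (f b)\<close> is in \<open>A \<inter> A'\<close>.\<close>

lemma graph_Int_trivial_iff:
  assumes A: "subspace A" and A': "subspace A'"
    and B: "B \<subseteq> A'" "indep_mod (A \<inter> A') (\<lambda>b. b) B" "gen (A \<inter> A') (\<lambda>b. b) B = A'"
    and C: "indep_mod A (\<lambda>c. c) C" "B \<subseteq> C"
    and f: "\<And>c. c \<in> C \<Longrightarrow> f c \<in> A"
  shows "graph C f \<inter> A' = {0} \<longleftrightarrow> indep_mod (A \<inter> A') f B"
proof
  have D: "subspace (A \<inter> A')" using A A' by (rule subspace_inter)
  have restr: "(\<Sum>c\<in>C. (if c \<in> B then u c else 0) *s g c) = (\<Sum>c\<in>B. u c *s g c)" for u g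
    using C(2) by (intro sum.mono_neutral_cong_right) auto
  {
    assume triv: "graph C f \<inter> A' = {0}"
    show "indep_mod (A \<inter> A') f B"
      unfolding indep_mod_def
    proof (intro allI impI)
      fix u assume u: "(\<Sum>b\<in>B. u b *s f b) \<in> A \<inter> A'"
      let ?x = "\<Sum>b\<in>B. u b *s (b + f b)"
      have uB: "(\<Sum>b\<in>B. u b *s b) \<in> A'"
        using B(1) by (intro subspace_sum[OF A'] subspace_scale[OF A']) auto
      have "?x = 0 + (\<Sum>c\<in>C. (if c \<in> B then u c else 0) *s (c + f c))"
        using restr[of u "\<lambda>c. c + f c"] by simp
      then have "?x \<in> graph C f"
        unfolding graph_def by (simp only:) (rule genI, simp)
      moreover have "?x \<in> A'"
        unfolding sum_add_scale using u uB by (auto intro: subspace_add[OF A'])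
      ultimately have "?x = 0" using triv by blast
      then have "(\<Sum>b\<in>B. u b *s b) = - (\<Sum>b\<in>B. u b *s f b)"
        by (simp add: sum_add_scale eq_neg_iff_add_eq_0)
      then have "(\<Sum>b\<in>B. u b *s b) \<in> A \<inter> A'"
        using subspace_neg[OF D u] by simp
      then show "\<forall>b\<in>B. u b = 0" using indep_modD[OF B(2)] by blast
    qed
  }
  {
    assume ind: "indep_mod (A \<inter> A') f B"
    show "graph C f \<inter> A' = {0}"
    proof (intro equalityI subsetI)
      fix x assume x: "x \<in> graph C f \<inter> A'"
      then obtain u where u: "x = (\<Sum>c\<in>C. u c *s (c + f c))"
        by (auto simp: graph_def gen_def)
      from x B(3) have "x \<in> gen (A \<inter> A') (\<lambda>b. b) B" by simp
      then obtain a v where a: "a \<in> A \<inter> A'" and v: "x = a + (\<Sum>b\<in>B. v b *s b)"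
        by (auto simp: gen_def)
      let ?v = "\<lambda>c. if c \<in> B then v c else 0"
      have "(\<Sum>c\<in>C. (u c - ?v c) *s (c + f c)) = x - (\<Sum>c\<in>B. v c *s (c + f c))"
        using restr[of v "\<lambda>c. c + f c"] u
        by (simp add: scale_left_diff_distrib sum_subtractf)
      also have "\<dots> = a - (\<Sum>b\<in>B. v b *s f b)"
        unfolding sum_add_scale v by simp
      also have "\<dots> \<in> A"
        using a C(2) f by (intro subspace_diff A subspace_sum subspace_scale) auto
      \<comment> \<open>Comparing coordinates modulo \<open>A\<close> forces \<open>u\<close> to vanish outside \<open>B\<close> and to agree with \<open>v\<close> on it.\<close>
      finally have mem: "(\<Sum>c\<in>C. (u c - ?v c) *s (c + f c)) \<in> A" .
      have "u c - ?v c = 0" if "c \<in> C" for c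
        by (rule graph_mem_imp_coeffs_0[where f = f, OF A C(1) _ mem that]) (rule f)
      then have "u c = ?v c" if "c \<in> C" for c using that eq_iff_diff_eq_0 by blast
      then have "x = (\<Sum>c\<in>C. ?v c *s (c + f c))" unfolding u by (intro sum.cong) simp_all
      then have xv: "x = (\<Sum>c\<in>B. v c *s (c + f c))" using restr by simp
      then have "(\<Sum>b\<in>B. v b *s f b) = a" using v by (simp add: sum_add_scale)
      then have "v b = 0" if "b \<in> B" for b using indep_modD[OF ind _ that] a by blast
      with xv show "x \<in> {0}" by simp
    qed (use A' subspace_0[OF subspace_gen[OF subspace_single_0]] in \<open>auto simp: graph_def subspace_0\<close>)
  }
qed

section \<open>The number of common complements of two subspaces\<close>

text \<open>The values on \<open>E\<close> are unrestricted.\<close>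

lemma card_indep_families_extend:
  assumes "finite E" "finite B" "B \<inter> E = {}"
  shows "card {f \<in> B \<union> E \<rightarrow>\<^sub>E A. indep_mod D f B}
    = card {f \<in> B \<rightarrow>\<^sub>E A. indep_mod D f B} * card A ^ card E"
  using assms(1,3)
proof (induction E rule: finite_induct)
  case (insert x E)
  have "card {f \<in> insert x (B \<union> E) \<rightarrow>\<^sub>E A. indep_mod D f B \<and> f x \<notin> {}}
    = card {f \<in> B \<union> E \<rightarrow>\<^sub>E A. indep_mod D f B} * card A"
    using insert assms(2) by (intro card_PiE_insert_filter) (auto intro!: indep_mod_cong)
  with insert show ?case by simp
qed simp

text \<open>Take a basis \<open>B\<close> of \<open>A'\<close> modulo \<open>A \<inter> A'\<close> and a basis \<open>E\<close> of the whole space modulo \<open>A + A'\<close>; then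
  \<open>C = B \<union> E\<close> is a basis modulo \<open>A\<close>, with \<open>card B = N - k - l\<close> and \<open>card E = 2 * k + l - N\<close>. The common
  complements are the graphs of those \<open>f : C \<rightarrow> A\<close> that are independent modulo \<open>A \<inter> A'\<close> on \<open>B\<close> and
  arbitrary on \<open>E\<close>. In particular \<open>2 * k + l - N\<close> is not truncated.\<close>

lemma card_common_complements:
  assumes A: "subspace A" "dim A = N - k" and A': "subspace A'" "dim A' = N - k"
    and k: "k \<le> N" and l: "dim (A \<inter> A') = l"
  shows "real (card {W. is_complement A W \<and> is_complement A' W})
    = real q ^ ((2 * k + l - N) * (N - k)) * (\<Prod>i\<in>{l..<N - k}. real q ^ (N - k) - real q ^ i)"
    and "N \<le> 2 * k + l" "l \<le> N - k"
proof -
  let ?D = "A \<inter> A'" and ?S = "{x + y | x y. x \<in> A \<and> y \<in> A'}"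
  have D: "subspace ?D" using A A' by (simp add: subspace_inter)
  have S: "subspace ?S" using A A' by (simp add: subspace_sums)
  obtain B where B: "B \<subseteq> A'" "indep_mod ?D (\<lambda>b. b) B" "gen ?D (\<lambda>b. b) B = A'"
    "dim A' = dim ?D + card B"
    using basis_mod_exists[OF D A'(1)] by blast
  obtain E where E: "indep_mod ?S (\<lambda>b. b) E" "dim UNIV = dim ?S + card E"
    using basis_mod_exists[OF S subspace_UNIV] by blast
  have A'S: "A' \<subseteq> ?S"
  proof
    fix x assume "x \<in> A'"
    then show "x \<in> ?S" using subspace_0[OF A(1)] by (intro CollectI exI[of _ 0] exI[of _ x]) simp
  qed
  have AS: "A \<subseteq> ?S"
  proof
    fix x assume "x \<in> A"
    then show "x \<in> ?S" using subspace_0[OF A'(1)] by (intro CollectI exI[of _ x] exI[of _ 0]) simp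
  qed
  have BE: "B \<inter> E = {}"
  proof (rule ccontr)
    assume "B \<inter> E \<noteq> {}"
    then obtain e where e: "e \<in> B" "e \<in> E" by blast
    then have "(\<Sum>b\<in>E. (if b = e then 1 else 0) *s b) = e"
      using e sum.delta[of E e "\<lambda>b. b"] by (simp add: if_distrib[of "\<lambda>c. c *s _"] cong: if_cong)
    with indep_modD[OF E(1) _ e(2), of "\<lambda>b. if b = e then 1 else 0"] A'S B(1) e show False by auto
  qed
  let ?C = "B \<union> E"
  have sum_C: "(\<Sum>c\<in>?C. u c *s c) = (\<Sum>b\<in>B. u b *s b) + (\<Sum>e\<in>E. u e *s e)" for u
    by (intro sum.union_disjoint BE) auto
  have C: "indep_mod A (\<lambda>c. c) ?C"
    unfolding indep_mod_def
  proof (intro allI impI)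
    fix u assume u: "(\<Sum>c\<in>?C. u c *s c) \<in> A"
    have uB: "(\<Sum>b\<in>B. u b *s b) \<in> A'"
      using B(1) A' by (intro subspace_sum subspace_scale) auto
    have "(\<Sum>c\<in>?C. u c *s c) - (\<Sum>b\<in>B. u b *s b) \<in> ?S"
      using u uB A'S AS by (intro subspace_diff[OF S]) auto
    then have "(\<Sum>e\<in>E. u e *s e) \<in> ?S" by (simp add: sum_C)
    then have uE: "\<forall>e\<in>E. u e = 0" using indep_modD[OF E(1)] by blast
    with u have "(\<Sum>b\<in>B. u b *s b) \<in> A" by (simp add: sum_C)
    with uB have "\<forall>b\<in>B. u b = 0" using indep_modD[OF B(2)] by blast
    with uE show "\<forall>c\<in>?C. u c = 0" by blast
  qed
  have dimS: "dim ?S + l = 2 * (N - k)"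
    using dim_sums_Int[OF A(1) A'(1)] A A' l by simp
  have cE: "card E = 2 * k + l - N" and le1: "N \<le> 2 * k + l"
    using E(2) dimS k dim_space by simp_all
  have cB: "card B = N - k - l" and le2: "l \<le> N - k" using B(4) A' l by simp_all
  show "N \<le> 2 * k + l" "l \<le> N - k" by fact+
  have "card ?C = card B + card E" by (intro card_Un_disjoint BE) auto
  then have dC: "N = dim A + card ?C" using cE cB le1 le2 A k by simp
  have bij: "bij_betw (graph ?C) (?C \<rightarrow>\<^sub>E A) {W. is_complement A W}"
    by (rule bij_betw_graph[OF A(1) C dC])
  have iff: "is_complement A' (graph ?C f) \<longleftrightarrow> indep_mod ?D f B" if f: "f \<in> ?C \<rightarrow>\<^sub>E A" for f
  proof -
    have W: "is_complement A (graph ?C f)" using bij f by (auto simp: bij_betw_def)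
    then have "subspace (graph ?C f)" by (simp add: is_complement_def)
    moreover have "dim A' + dim (graph ?C f) = N"
      using dim_complement[OF A(1) W] A A' by simp
    ultimately have "is_complement A' (graph ?C f) \<longleftrightarrow> graph ?C f \<inter> A' = {0}"
      using A' by (simp add: is_complement_iff_Int Int_commute)
    also have "\<dots> \<longleftrightarrow> indep_mod ?D f B"
      using f by (intro graph_Int_trivial_iff A A' B C) auto
    finally show ?thesis .
  qed
  have "bij_betw (graph ?C) {f \<in> ?C \<rightarrow>\<^sub>E A. indep_mod ?D f B}
      {W. is_complement A W \<and> is_complement A' W}"
  proof (rule bij_betw_subset[OF bij])
    show "graph ?C ` {f \<in> ?C \<rightarrow>\<^sub>E A. indep_mod ?D f B}
        = {W. is_complement A W \<and> is_complement A' W}" (is "?L = ?R")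
    proof (intro equalityI subsetI)
      fix W assume "W \<in> ?L"
      then show "W \<in> ?R" using iff bij by (auto simp: bij_betw_def)
    next
      fix W assume W: "W \<in> ?R"
      then have "W \<in> graph ?C ` (?C \<rightarrow>\<^sub>E A)" using bij by (simp add: bij_betw_def)
      with W show "W \<in> ?L" using iff by blast
    qed
  qed auto
  then have "card {W. is_complement A W \<and> is_complement A' W}
      = card {f \<in> ?C \<rightarrow>\<^sub>E A. indep_mod ?D f B}"
    by (simp add: bij_betw_same_card)
  also have "\<dots> = card {f \<in> B \<rightarrow>\<^sub>E A. indep_mod ?D f B} * card A ^ card E"
    by (intro card_indep_families_extend BE) auto
  finally have "real (card {W. is_complement A W \<and> is_complement A' W})
      = (\<Prod>i<N - k - l. real q ^ (N - k) - real q ^ (l + i)) * (real q ^ (N - k)) ^ (2 * k + l - N)"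
    using card_indep_families[OF D A(1), of B] A l cB cE by (simp add: card_subspace)
  also have "(\<Prod>i<N - k - l. real q ^ (N - k) - real q ^ (l + i))
      = (\<Prod>i\<in>{l..<N - k}. real q ^ (N - k) - real q ^ i)"
    by (subst prod.atLeastLessThan_shift_0) (simp add: lessThan_atLeast0)
  finally show "real (card {W. is_complement A W \<and> is_complement A' W})
    = real q ^ ((2 * k + l - N) * (N - k)) * (\<Prod>i\<in>{l..<N - k}. real q ^ (N - k) - real q ^ i)"
    by (simp add: power_mult[symmetric] mult.commute)
qed

text \<open>This is the case \<open>A' = A\<close>, where the intersection has dimension \<open>N - k\<close> and the product is empty.\<close>

lemma card_complements:
  assumes "subspace A" "dim A = N - k" "k \<le> N"
  shows "real (card {W. is_complement A W}) = real q ^ (k * (N - k))"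
proof -
  have "2 * k + (N - k) - N = k" using assms by simp
  then show ?thesis
    using card_common_complements(1)[OF assms(1,2,1,2,3), of "N - k"] assms by simp
qed

text \<open>The meaning of \<open>nu\<close>, by inclusion and exclusion: it counts the \<open>k\<close>-dimensional subspaces that are
  complements of neither \<open>A\<close> nor \<open>A'\<close>.\<close>

lemma nu_eq_card:
  assumes A: "subspace A" "dim A = N - k" and A': "subspace A'" "dim A' = N - k" and k: "k \<le> N"
  shows "nu q N k (dim (A \<inter> A')) =
    real (card {W. subspace W \<and> dim W = k \<and> \<not> is_complement A W \<and> \<not> is_complement A' W})"
    (is "_ = real (card ?R)")
proof -
  let ?K = "{W. subspace W \<and> dim W = k}"
  let ?C = "{W. is_complement A W}" and ?C' = "{W. is_complement A' W}"
  have "W \<in> ?K" if "is_complement A W" for W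
    using that dim_complement[OF A(1) that] A k by (auto simp: is_complement_def)
  moreover have "W \<in> ?K" if "is_complement A' W" for W
    using that dim_complement[OF A'(1) that] A' k by (auto simp: is_complement_def)
  ultimately have sub: "?C \<union> ?C' \<subseteq> ?K" by blast
  have "?R = ?K - (?C \<union> ?C')" by blast
  then have "card ?R = card ?K - card (?C \<union> ?C')"
    using sub by (simp add: card_Diff_subset)
  then have "real (card ?R) = real (card ?K) - real (card (?C \<union> ?C'))"
    using card_mono[OF _ sub] by (simp add: of_nat_diff)
  moreover have "real (card ?C) + real (card ?C')
      = real (card (?C \<union> ?C')) + real (card (?C \<inter> ?C'))"
    using card_Un_Int[of ?C ?C'] by (simp flip: of_nat_add)
  moreover have "?C \<inter> ?C' = {W. is_complement A W \<and> is_complement A' W}" by blast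
  ultimately show ?thesis
    using card_subspaces_of_dim[OF k] card_complements[OF A k] card_complements[OF A' k]
      card_common_complements(1)[OF A A' k refl]
    by (simp add: nu_def)
qed

end

section \<open>Monotonicity of \<open>nu\<close> in the dimension of the intersection\<close>

text \<open>With \<open>n = N - k\<close>, passing from \<open>l\<close> to \<open>l + 1\<close> replaces the factor \<open>q ^ n - q ^ l\<close> of the last summand
  of \<open>nu\<close> by \<open>q ^ n\<close>.\<close>

lemma nu_Suc_mono:
  assumes q: "q \<ge> 1" and k: "k \<le> N" and l: "N \<le> 2 * k + l" "l < N - k"
  shows "nu q N k l \<le> nu q N k (Suc l)"
proof -
  define n where "n = N - k"
  define P where "P = (\<Prod>i\<in>{Suc l..<n}. real q ^ n - real q ^ i)"
  define e where "e = (2 * k + l - N) * n"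
  have "P \<ge> 0" unfolding P_def using q by (intro prod_nonneg) (auto intro!: power_increasing)
  moreover have "(\<Prod>i\<in>{l..<n}. real q ^ n - real q ^ i) = (real q ^ n - real q ^ l) * P"
    using l unfolding P_def n_def by (subst prod.atLeast_Suc_lessThan) auto
  moreover have "(2 * k + Suc l - N) * n = e + n"
    using l by (simp add: e_def Suc_diff_le)
  ultimately show ?thesis
    by (simp add: nu_def n_def[symmetric] P_def[symmetric] e_def[symmetric] power_add
        mult.assoc mult_left_mono mult_right_mono)
qed

lemma nu_mono:
  assumes "q \<ge> 1" "k \<le> N" "N \<le> 2 * k + l" "l \<le> m" "m \<le> N - k"
  shows "nu q N k l \<le> nu q N k m"
  using assms(4,5)
proof (induction m rule: dec_induct)
  case (step m)
  then have "nu q N k m \<le> nu q N k (Suc m)"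
    using assms by (intro nu_Suc_mono) auto
  with step show ?case by simp
qed simp

section \<open>Bounds by double counting\<close>

text \<open>For a relation \<open>b\<close> in which every \<open>A \<in> \<A>\<close> is related to exactly \<open>r\<close> elements of \<open>K\<close>, let \<open>F\<close> be the
  set of those \<open>W \<in> K\<close> that are related to some \<open>A\<close>, and let \<open>d W\<close> be the number of these \<open>A\<close>. Then
  \<open>\<Sum>W\<in>F. d W = card \<A> * r\<close>, and \<open>\<Sum>W\<in>F. (d W)\<^sup>2\<close> counts the common neighbours of all pairs. The first
  bound is the Cauchy-Schwarz inequality for \<open>1\<close> and \<open>d\<close>; the second one is \<open>d W \<ge> 1\<close>.\<close>

lemma card_covered_bounds:
  fixes b :: "'a \<Rightarrow> 'b \<Rightarrow> bool"
  assumes "finite \<A>" "finite K"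
    and row: "\<And>A. A \<in> \<A> \<Longrightarrow> real (card {W\<in>K. b A W}) = r"
  defines "F \<equiv> {W\<in>K. \<exists>A\<in>\<A>. b A W}"
  shows "(real (card \<A>) * r)\<^sup>2 \<le>
      real (card F) * (\<Sum>A\<in>\<A>. \<Sum>A'\<in>\<A>. real (card {W\<in>K. b A W \<and> b A' W}))"
    and "real (card F) \<le> real (card \<A>) * r"
proof -
  define d where "d W = (\<Sum>A\<in>\<A>. of_bool (b A W) :: real)" for W
  have F: "finite F" using \<open>finite K\<close> by (simp add: F_def)
  have sum_F: "(\<Sum>W\<in>F. of_bool (b A W) * of_bool (b A' W)) = real (card {W\<in>K. b A W \<and> b A' W})"
    if "A \<in> \<A>" for A A'
  proof -
    have "(\<Sum>W\<in>F. of_bool (b A W) * of_bool (b A' W)) = (\<Sum>W\<in>F. of_bool (b A W \<and> b A' W) :: real)"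
      by (simp add: of_bool_conj)
    also have "\<dots> = real (card (F \<inter> {W. b A W \<and> b A' W}))"
      using F by (simp add: sum_of_bool_eq)
    also have "F \<inter> {W. b A W \<and> b A' W} = {W\<in>K. b A W \<and> b A' W}"
      using that by (auto simp: F_def)
    finally show ?thesis .
  qed
  have col: "(\<Sum>W\<in>F. of_bool (b A W) :: real) = r" if "A \<in> \<A>" for A
    using sum_F[OF that, of A] row[OF that] by (simp flip: of_bool_conj)
  have d: "(\<Sum>W\<in>F. d W) = real (card \<A>) * r"
    unfolding d_def by (subst sum.swap) (simp add: col)
  have "(\<Sum>W\<in>F. (d W)\<^sup>2) = (\<Sum>W\<in>F. \<Sum>A\<in>\<A>. \<Sum>A'\<in>\<A>. of_bool (b A W) * of_bool (b A' W))"
    by (simp add: d_def power2_eq_square sum_product)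
  also have "\<dots> = (\<Sum>A\<in>\<A>. \<Sum>W\<in>F. \<Sum>A'\<in>\<A>. of_bool (b A W) * of_bool (b A' W))"
    by (rule sum.swap)
  also have "\<dots> = (\<Sum>A\<in>\<A>. \<Sum>A'\<in>\<A>. \<Sum>W\<in>F. of_bool (b A W) * of_bool (b A' W))"
    by (intro sum.cong refl sum.swap)
  also have "\<dots> = (\<Sum>A\<in>\<A>. \<Sum>A'\<in>\<A>. real (card {W\<in>K. b A W \<and> b A' W}))"
    by (intro sum.cong refl sum_F)
  finally have d2: "(\<Sum>W\<in>F. (d W)\<^sup>2) = (\<Sum>A\<in>\<A>. \<Sum>A'\<in>\<A>. real (card {W\<in>K. b A W \<and> b A' W}))" .
  show "(real (card \<A>) * r)\<^sup>2 \<le>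
      real (card F) * (\<Sum>A\<in>\<A>. \<Sum>A'\<in>\<A>. real (card {W\<in>K. b A W \<and> b A' W}))"
    using Cauchy_Schwarz_ineq_sum[of "\<lambda>_. 1" d F] by (simp add: d d2)
  have "d W \<ge> 1" if W: "W \<in> F" for W
  proof -
    obtain A where A: "A \<in> \<A>" "b A W" using W by (auto simp: F_def)
    have "of_bool (b A W) \<le> d W"
      unfolding d_def by (rule member_le_sum) (use A assms in auto)
    with A show ?thesis by simp
  qed
  then have "(\<Sum>W\<in>F. 1) \<le> (\<Sum>W\<in>F. d W)" by (intro sum_mono)
  then show "real (card F) \<le> real (card \<A>) * r" by (simp add: d)
qed

text \<open>The case \<open>s = 0\<close> relies on \<open>x / 0 = 0\<close>.\<close>

lemma divide_le_of_le_mult: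
  fixes x s y :: real
  assumes "x \<le> y * s" "0 \<le> y" "0 \<le> s"
  shows "x / s \<le> y"
  using assms by (cases "s = 0") (simp_all add: divide_le_eq)

section \<open>The number of subspaces that are not common complements\<close>

theorem theorem3p6:
  fixes scale :: "'f::{field,finite} \<Rightarrow> 'v::ab_group_add \<Rightarrow> 'v"
    and Basis :: "'v set"
    and q N k :: nat
    and \<A> \<F> :: "'v set set"
  assumes "finite_dimensional_vector_space scale Basis"
    and "q = CARD('f)"
    and "vector_space.dim scale (UNIV :: 'v set) = N"
    and "N \<ge> 3"
    and "1 \<le> k" and "k \<le> N - 1"
    and "\<A> \<noteq> {}"
    and "\<And>A. A \<in> \<A> \<Longrightarrow> module.subspace scale A \<and> vector_space.codim scale A = k"
    and "\<F> = {W. module.subspace scale W \<and> vector_space.dim scale W = k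
                 \<and> \<not> vector_space.is_common_complement scale \<A> W}"
  shows
    "(nu q N k (N - k))\<^sup>2 * (real (card \<A>))\<^sup>2 /
        (\<Sum>l=0..N - k. nu q N k l *
           real (card {(A, A'). A \<in> \<A> \<and> A' \<in> \<A> \<and> vector_space.dim scale (A \<inter> A') = l}))
       \<le> real (card \<F>)
     \<and> real (card \<F>) \<le> real (card \<A>) * nu q N k (N - k)
     \<and> (\<forall>lmax. card \<A> \<ge> 2 \<and>
          lmax = Max {vector_space.dim scale (A \<inter> A') | A A'. A \<in> \<A> \<and> A' \<in> \<A> \<and> A \<noteq> A'} \<longrightarrow>
          (nu q N k (N - k))\<^sup>2 * real (card \<A>) /
            (nu q N k (N - k) + (real (card \<A>) - 1) * nu q N k lmax)
            \<le> real (card \<F>)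
          \<and> real (card \<F>) \<le> real (card \<A>) * nu q N k (N - k))"
proof -
  interpret finite_dimensional_vector_space scale Basis by fact
  interpret finite_field_space scale Basis q N
    using assms(2,3) by unfold_locales
  have k: "k \<le> N" using assms(6) by simp
  define n where "n = N - k"
  define c where "c = nu q N k n"
  define m where "m = real (card \<A>)"
  define K where "K = {W. subspace W \<and> dim W = k}"
  have A: "subspace A" "dim A = N - k" if "A \<in> \<A>" for A
    using assms(8)[OF that] assms(3,5) by (auto simp: codim_def)
  have F: "\<F> = {W\<in>K. \<exists>A\<in>\<A>. \<not> is_complement A W}"
    using assms(9) by (auto simp: K_def is_common_complement_def)
  have pair: "real (card {W\<in>K. \<not> is_complement A W \<and> \<not> is_complement A' W})
      = nu q N k (dim (A \<inter> A'))" if "A \<in> \<A>" "A' \<in> \<A>" for A A'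
    using nu_eq_card[OF A[OF that(1)] A[OF that(2)] k] by (simp add: K_def conj_assoc)
  have single: "real (card {W\<in>K. \<not> is_complement A W}) = c" if "A \<in> \<A>" for A
    using pair[OF that that] A[OF that] by (simp add: c_def n_def)
  define S where "S = (\<Sum>A\<in>\<A>. \<Sum>A'\<in>\<A>. nu q N k (dim (A \<inter> A')))"
  have lower: "(m * c)\<^sup>2 \<le> real (card \<F>) * S" and upper: "real (card \<F>) \<le> m * c"
    using card_covered_bounds[of \<A> K "\<lambda>A W. \<not> is_complement A W" c] single pair
    unfolding F m_def S_def by (simp_all cong: sum.cong)
  have nonneg: "0 \<le> nu q N k (dim (A \<inter> A'))" if "A \<in> \<A>" "A' \<in> \<A>" for A A'
    using pair[OF that] by (metis of_nat_0_le_iff)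
  have range: "N \<le> 2 * k + dim (A \<inter> A')" "dim (A \<inter> A') \<le> n" if "A \<in> \<A>" "A' \<in> \<A>" for A A'
    using card_common_complements(2,3)[OF A[OF that(1)] A[OF that(2)] k refl]
    by (simp_all add: n_def)
  have "S = (\<Sum>p\<in>\<A> \<times> \<A>. nu q N k (dim (fst p \<inter> snd p)))"
    by (simp add: S_def sum.cartesian_product case_prod_unfold)
  also have "\<dots> = (\<Sum>l=0..n. \<Sum>p\<in>{p\<in>\<A> \<times> \<A>. dim (fst p \<inter> snd p) = l}. nu q N k (dim (fst p \<inter> snd p)))"
    by (rule sum.group[symmetric]) (use range in auto)
  also have "\<dots> = (\<Sum>l=0..n. nu q N k l *
      real (card {(A, A'). A \<in> \<A> \<and> A' \<in> \<A> \<and> dim (A \<inter> A') = l}))"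
  proof (rule sum.cong)
    fix l
    have "{p\<in>\<A> \<times> \<A>. dim (fst p \<inter> snd p) = l} = {(A, A'). A \<in> \<A> \<and> A' \<in> \<A> \<and> dim (A \<inter> A') = l}"
      by auto
    moreover have "(\<Sum>p\<in>{p\<in>\<A> \<times> \<A>. dim (fst p \<inter> snd p) = l}. nu q N k (dim (fst p \<inter> snd p)))
        = (\<Sum>p\<in>{p\<in>\<A> \<times> \<A>. dim (fst p \<inter> snd p) = l}. nu q N k l)"
      by (rule sum.cong) auto
    ultimately show "(\<Sum>p\<in>{p\<in>\<A> \<times> \<A>. dim (fst p \<inter> snd p) = l}. nu q N k (dim (fst p \<inter> snd p)))
        = nu q N k l * real (card {(A, A'). A \<in> \<A> \<and> A' \<in> \<A> \<and> dim (A \<inter> A') = l})"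
      by simp
  qed simp
  finally have S: "S = (\<Sum>l=0..n. nu q N k l *
      real (card {(A, A'). A \<in> \<A> \<and> A' \<in> \<A> \<and> dim (A \<inter> A') = l}))" .
  have S0: "S \<ge> 0" unfolding S_def by (intro sum_nonneg nonneg)
  have first: "c\<^sup>2 * m\<^sup>2 / S \<le> real (card \<F>)"
    using lower S0 by (intro divide_le_of_le_mult) (simp_all add: power_mult_distrib mult.commute)
  have second: "c\<^sup>2 * m / (c + (m - 1) * nu q N k lmax) \<le> real (card \<F>)"
    if two: "card \<A> \<ge> 2" and lmax: "lmax = Max {dim (A \<inter> A') | A A'. A \<in> \<A> \<and> A' \<in> \<A> \<and> A \<noteq> A'}" for lmax
  proof -
    let ?L = "{dim (A \<inter> A') | A A'. A \<in> \<A> \<and> A' \<in> \<A> \<and> A \<noteq> A'}"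
    have "?L \<subseteq> {..n}" using range by auto
    then have fin: "finite ?L" by (rule finite_subset) simp
    have "\<not> is_singleton \<A>" using two by (auto simp: is_singleton_altdef)
    then obtain A1 A2 where "A1 \<in> \<A>" "A2 \<in> \<A>" "A1 \<noteq> A2"
      using assms(7) by (metis ex_in_conv is_singletonI')
    then have "?L \<noteq> {}" by blast
    from Max_in[OF fin this] obtain B B' where B: "B \<in> \<A>" "B' \<in> \<A>" "lmax = dim (B \<inter> B')"
      unfolding lmax by blast
    have le: "nu q N k (dim (A \<inter> A')) \<le> nu q N k lmax"
      if "A \<in> \<A>" "A' \<in> \<A>" "A \<noteq> A'" for A A'
    proof (rule nu_mono)
      show "dim (A \<inter> A') \<le> lmax"
        unfolding lmax using that by (intro Max_ge fin) blast
    qed (use q_gt_1 k range that B in \<open>auto simp: n_def\<close>)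
    \<comment> \<open>Only the diagonal pair has an intersection of dimension \<open>N - k\<close>; it is
      kept apart, and monotonicity bounds the other pairs.\<close>
    have row: "(\<Sum>A'\<in>\<A>. nu q N k (dim (A \<inter> A'))) \<le> c + (m - 1) * nu q N k lmax"
      if AA: "A \<in> \<A>" for A
    proof -
      have "(\<Sum>A'\<in>\<A>. nu q N k (dim (A \<inter> A')))
          = nu q N k (dim (A \<inter> A)) + (\<Sum>A'\<in>\<A> - {A}. nu q N k (dim (A \<inter> A')))"
        by (rule sum.remove[OF _ AA]) simp
      also have "nu q N k (dim (A \<inter> A)) = c" using A[OF AA] by (simp add: c_def n_def)
      also have "(\<Sum>A'\<in>\<A> - {A}. nu q N k (dim (A \<inter> A'))) \<le> real (card (\<A> - {A})) * nu q N k lmax"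
        by (rule sum_bounded_above) (use le AA in auto)
      also have "real (card (\<A> - {A})) = m - 1"
        using AA two by (simp add: m_def of_nat_diff)
      finally show ?thesis by simp
    qed
    let ?d = "c + (m - 1) * nu q N k lmax"
    have m: "m > 0" using two by (simp add: m_def)
    have "S \<le> m * ?d"
      unfolding S_def m_def using row by (intro sum_bounded_above) (simp add: m_def)
    then have "(m * c)\<^sup>2 \<le> real (card \<F>) * (m * ?d)"
      using lower by (meson mult_left_mono of_nat_0_le_iff order_trans)
    then have "m * (c\<^sup>2 * m) \<le> m * (real (card \<F>) * ?d)"
      by (simp add: power2_eq_square algebra_simps)
    then have "c\<^sup>2 * m \<le> real (card \<F>) * ?d" using m by simp
    moreover have "?d \<ge> 0"
      using S0 \<open>S \<le> m * ?d\<close> m by (metis order_trans zero_le_mult_iff not_less)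
    ultimately show ?thesis by (intro divide_le_of_le_mult) simp_all
  qed
  show ?thesis
    using first second upper by (auto simp: S m_def c_def n_def)
qed

end
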